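(* Let $n$ be a positive integer and let $\Phi$ be an arbitrary admissible function. Then there exists a compact set $K\subset\mathbb{R}^n$ for which $$\dim_U K=0\quad\text{and}\quad\overline{\dim}_M^\Phi K=n.$$ Consequently, $\dim_P K=n$.
   Context: $|E|$ denotes the diameter of a set $E$. $\mathcal{D}$ is the family of all sets $D\subset(0,\infty)$ with $\inf D=0$ that are open in the Sorgenfrey topology (generated by the intervals $[a,b)$), i.e. for every $t\in D$ there is $\delta>0$ with $[t,t+\delta)\subset D$. For $D\in\mathcal{D}$, $E\subset\mathbb{R}^n$ and $s\ge0$ let $$\mathcal{H}^s_{D,\infty}(E)=\inf\left\{\sum_{i=1}^\infty|E_i|^s: E\subset\bigcup_{i=1}^\infty E_i,\ |E_i|\in D\text{ for all }i\right\},\qquad \dim_H^D E=\inf\{s\ge0:\mathcal{H}^s_{D,\infty}(E)=0\}.$$ The universal restricted Hausdorff dimension is $\dim_U E=\sup\{\dim_H^D E: D\in\mathcal{D}\}$. A function $\Phi\colon(0,\infty)\to(0,\infty)$ is admissible if it is non-decreasing, $0<\Phi(\delta)\le\delta$ for all $\delta>0$, and $\Phi(\delta)/\delta\to0$ as $\delta\to0+$. The upper $\Phi$-intermediate dimension $\overline{\dim}^\Phi X$ of a bounded set $X\subset\mathbb{R}^n$ is the infimum of those $s\ge0$ such that for every $\varepsilon>0$ there is $\delta_0>0$ such that for every $\delta\in(0,\delta_0)$ there is a cover $\{U_i\}_{i\ge1}$ of $X$ with $\Phi(\delta)\le|U_i|\le\delta$ for all $i$ and $\sum_i|U_i|^s\le\varepsilon$.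 The modified upper $\Phi$-intermediate dimension of $X\subset\mathbb{R}^n$ is $$\overline{\dim}_M^\Phi X=\inf\left\{\sup_i\overline{\dim}^\Phi X_i: X=\bigcup_{i=1}^\infty X_i,\ X_i\text{ bounded}\right\}.$$ $\dim_P$ is the packing dimension. *)

theory Defs
  imports "HOL-Analysis.Analysis"
begin

text \<open>
  Dimensions are \<^typ>\<open>ereal\<close>-valued and contents and measures \<^typ>\<open>ennreal\<close>-valued, so that every
  infimum, supremum and sum below is the true one and no default values occur.
  Since \<^const>\<open>diameter\<close> is real-valued and unspecified on unbounded sets, covering sets are
  required to be bounded wherever their diameter is prescribed; for a set of finite diameter this
  is no restriction.
\<close>

definition sorgenfrey_scales :: "real set set" where
  "sorgenfrey_scales =
    {D. D \<subseteq> {0<..} \<and> D \<noteq> {} \<and> Inf D = 0 \<and> (\<forall>t\<in>D. \<exists>\<delta>>0. {t..<t + \<delta>} \<subseteq> D)}"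

definition restricted_content :: "real set \<Rightarrow> real \<Rightarrow> 'a::euclidean_space set \<Rightarrow> ennreal" where
  "restricted_content D s E =
    Inf {(\<Sum>i. ennreal (diameter (U i) powr s)) | U :: nat \<Rightarrow> 'a set.
           E \<subseteq> (\<Union>i. U i) \<and> (\<forall>i. bounded (U i) \<and> diameter (U i) \<in> D)}"

definition restricted_hausdorff_dim :: "real set \<Rightarrow> 'a::euclidean_space set \<Rightarrow> ereal" where
  "restricted_hausdorff_dim D E = Inf {ereal s | s. 0 \<le> s \<and> restricted_content D s E = 0}"

definition universal_dim :: "'a::euclidean_space set \<Rightarrow> ereal" where
  "universal_dim E = (SUP D\<in>sorgenfrey_scales. restricted_hausdorff_dim D E)"

text \<open>Only the values of \<open>\<Phi>\<close> on the positive half-line matter.\<close>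

definition admissible :: "(real \<Rightarrow> real) \<Rightarrow> bool" where
  "admissible \<Phi> \<longleftrightarrow>
    mono_on {0<..} \<Phi> \<and> (\<forall>\<delta>>0. 0 < \<Phi> \<delta> \<and> \<Phi> \<delta> \<le> \<delta>) \<and>
    ((\<lambda>\<delta>. \<Phi> \<delta> / \<delta>) \<longlongrightarrow> 0) (at_right 0)"

text \<open>
  The covers here are finite or countable, indexed by an arbitrary set \<open>I\<close> of naturals. Insisting on
  infinite sequences would be wrong: all the diameters are at least \<open>\<Phi> \<delta> > 0\<close>, so every infinite
  sum would diverge.
\<close>

definition upper_intermediate_dim :: "(real \<Rightarrow> real) \<Rightarrow> 'a::euclidean_space set \<Rightarrow> ereal" where
  "upper_intermediate_dim \<Phi> X =
    Inf {ereal s | s. 0 \<le> s \<and>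
      (\<forall>\<epsilon>>0. \<exists>\<delta>\<^sub>0>0. \<forall>\<delta>\<in>{0<..<\<delta>\<^sub>0}. \<exists>(I :: nat set) (U :: nat \<Rightarrow> 'a set).
         X \<subseteq> (\<Union>i\<in>I. U i) \<and>
         (\<forall>i\<in>I. bounded (U i) \<and> \<Phi> \<delta> \<le> diameter (U i) \<and> diameter (U i) \<le> \<delta>) \<and>
         (\<Sum>\<^sub>\<infinity>i\<in>I. ennreal (diameter (U i) powr s)) \<le> ennreal \<epsilon>)}"

definition modified_upper_intermediate_dim ::
    "(real \<Rightarrow> real) \<Rightarrow> 'a::euclidean_space set \<Rightarrow> ereal" where
  "modified_upper_intermediate_dim \<Phi> X =
    Inf {(SUP i. upper_intermediate_dim \<Phi> (Y i)) | Y :: nat \<Rightarrow> 'a set.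
           X = (\<Union>i. Y i) \<and> (\<forall>i. bounded (Y i))}"

text \<open>
  The packing dimension is defined through the packing measures of Tricot: \<open>\<delta>\<close>-packings of \<open>E\<close> are
  finite or countable families of disjoint closed balls of radius at most \<open>\<delta>\<close> centred in \<open>E\<close>; the
  limit \<open>\<delta> \<rightarrow> 0\<close> is an infimum by monotonicity.
\<close>

definition packing_delta :: "real \<Rightarrow> real \<Rightarrow> 'a::euclidean_space set \<Rightarrow> ennreal" where
  "packing_delta s \<delta> E =
    Sup {(\<Sum>\<^sub>\<infinity>i\<in>I. ennreal (diameter (cball (x i) (r i)) powr s)) |
           (I :: nat set) (x :: nat \<Rightarrow> 'a) (r :: nat \<Rightarrow> real).
           (\<forall>i\<in>I. x i \<in> E \<and> 0 < r i \<and> r i \<le> \<delta>) \<and>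
           disjoint_family_on (\<lambda>i. cball (x i) (r i)) I}"

definition packing_premeasure :: "real \<Rightarrow> 'a::euclidean_space set \<Rightarrow> ennreal" where
  "packing_premeasure s E = (INF \<delta>\<in>{0<..}. packing_delta s \<delta> E)"

definition packing_measure :: "real \<Rightarrow> 'a::euclidean_space set \<Rightarrow> ennreal" where
  "packing_measure s E =
    Inf {(\<Sum>i. packing_premeasure s (Y i)) | Y :: nat \<Rightarrow> 'a set. E \<subseteq> (\<Union>i. Y i)}"

definition packing_dim :: "'a::euclidean_space set \<Rightarrow> ereal" where
  "packing_dim E = Inf {ereal s | s. 0 \<le> s \<and> packing_measure s E = 0}"

end

theory Submission
  imports Defs
begin

text \<open>
  Write \<open>d\<close> for the dimension of the ambient space. The set \<open>K\<close> is the closure of an increasing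
  union of finite sets \<open>P 0 \<subseteq> P 1 \<subseteq> \<dots>\<close>. At stage \<open>m\<close> one point \<open>v m\<close> of \<open>P m\<close> is selected,
  and \<open>P (Suc m)\<close> arises by adding a very fine net of the ball of radius \<open>\<rho> m / 2\<close> around \<open>v m\<close>;
  all later stages stay within distance \<open>\<rho> (Suc m)\<close> of \<open>P (Suc m)\<close>. The radius \<open>\<rho> m\<close> is chosen
  after \<open>P m\<close>, so small that \<open>card (P m)\<close> balls of that radius cost next to nothing.

  \<^emph>\<open>The universal dimension is 0.\<close> Up to one exceptional ball, the one around \<open>v m\<close>, the set \<open>K\<close>
  is covered by \<open>card (P m)\<close> balls of any prescribed diameter \<open>t\<close> with
  \<open>2 * \<rho> (Suc m) \<le> t < 2 * \<rho> m\<close>, and for every fixed exponent \<open>s > 0\<close> this costs at most \<open>2^-m\<close>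
  once \<open>m\<close> is large. A set \<open>D\<close> of scales accumulating at \<open>0\<close> meets infinitely many of these
  windows. The exceptional balls of these stages have radii tending to \<open>0\<close>, so at most one point
  of \<open>K\<close> lies in all of them, and every other point is covered at one of the stages. Thus a scale
  that is expensive inside one cluster is simply not used there; that cluster is left to the later
  stages, whose exceptional balls lie elsewhere or are much smaller
  (\<open>content_K_minus_cball_le\<close>, \<open>restricted_content_K\<close>).

  \<^emph>\<open>The intermediate dimension is full.\<close> The net of stage \<open>m\<close> has mesh \<open>\<Phi> (\<delta> m)\<close>, where \<open>\<delta> m\<close> is
  far smaller than \<open>\<rho> m\<close>. Sets with diameters \<open>d\<^sub>i \<ge> \<Phi> (\<delta> m)\<close> covering the net cannot distinguish it
  from the full ball, so a comparison of volumes gives \<open>\<Sum> d\<^sub>i ^ d \<ge> (\<rho> m / 4) ^ d\<close>. If also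
  \<open>d\<^sub>i \<le> \<delta> m\<close> and \<open>s < d\<close>, this forces \<open>\<Sum> d\<^sub>i powr s > 1\<close> for large \<open>m\<close>
  (\<open>DIM_le_upper_intermediate_dim\<close>). The points \<open>v m\<close> are selected so that every part of \<open>K\<close> is
  visited infinitely often. In any countable decomposition of \<open>K\<close>, Baire's theorem provides a piece
  that is dense in some part of \<open>K\<close>, and this piece inherits the lower bound.

  The remaining inequalities hold for all bounded sets: a packing at scale \<open>\<delta>\<close> that cannot be
  enlarged gives a cover by sets of diameter comparable to \<open>\<delta>\<close>, hence the modified upper
  intermediate dimension is at most the packing dimension, and the latter is at most \<open>d\<close> by volume.
\<close>

section \<open>Restricted content\<close>

lemma restricted_content_le:
  assumes "E \<subseteq> (\<Union>i. U i)" "\<And>i. bounded (U i)" "\<And>i. diameter (U i) \<in> D"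
  shows "restricted_content D s E \<le> (\<Sum>i. ennreal (diameter (U i) powr s))"
  unfolding restricted_content_def using assms by (intro Inf_lower) blast

lemma restricted_content_mono:
  assumes "E \<subseteq> F"
  shows "restricted_content D s E \<le> restricted_content D s F"
  unfolding restricted_content_def using assms by (intro Inf_superset_mono) blast

text \<open>
  The content is countably subadditive because covers of the pieces, each optimal up to a geometric
  error, can be interleaved into one sequence.
\<close>

lemma restricted_content_UN_le:
  "restricted_content D s (\<Union>k. E k) \<le> (\<Sum>k. restricted_content D s (E k))"
proof (rule ennreal_le_epsilon)
  fix e :: real
  assume fin: "(\<Sum>k. restricted_content D s (E k)) < top" and "0 < e"
  have "\<exists>U. E k \<subseteq> (\<Union>i. U i) \<and> (\<forall>i. bounded (U i) \<and> diameter (U i) \<in> D) \<and>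
      (\<Sum>i. ennreal (diameter (U i) powr s))
        \<le> restricted_content D s (E k) + ennreal (e * (1/2) ^ Suc k)" for k
  proof -
    have "restricted_content D s (E k) < top"
      using ennreal_suminf_lessD[OF fin] .
    then have "restricted_content D s (E k)
        < restricted_content D s (E k) + ennreal (e * (1/2) ^ Suc k)"
      using \<open>0 < e\<close> by (simp add: ennreal_zero_less_mult_iff)
    then show ?thesis
      unfolding restricted_content_def Inf_less_iff by (auto intro: less_imp_le)
  qed
  then obtain U where U: "\<And>k. E k \<subseteq> (\<Union>i. U k i)"
    "\<And>k i. bounded (U k i)" "\<And>k i. diameter (U k i) \<in> D"
    "\<And>k. (\<Sum>i. ennreal (diameter (U k i) powr s))
        \<le> restricted_content D s (E k) + ennreal (e * (1/2) ^ Suc k)"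
    by metis
  define V where "V n = (case prod_decode n of (k, i) \<Rightarrow> U k i)" for n
  have "(\<Union>k. E k) \<subseteq> (\<Union>n. V n)"
  proof
    fix x assume "x \<in> (\<Union>k. E k)"
    then obtain k i where "x \<in> U k i" using U(1) by blast
    then have "x \<in> V (prod_encode (k, i))" by (simp add: V_def)
    then show "x \<in> (\<Union>n. V n)" by blast
  qed
  then have "restricted_content D s (\<Union>k. E k) \<le> (\<Sum>n. ennreal (diameter (V n) powr s))"
    by (rule restricted_content_le) (auto simp: V_def U split: prod.split)
  also have "\<dots> = (\<Sum>n. (\<lambda>(k, i). ennreal (diameter (U k i) powr s)) (prod_decode n))"
    by (simp add: V_def case_prod_unfold)
  also have "\<dots> = (\<Sum>k. \<Sum>i. ennreal (diameter (U k i) powr s))"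
    by (rule suminf_ennreal_2dimen) simp
  also have "\<dots> \<le> (\<Sum>k. restricted_content D s (E k) + ennreal (e * (1/2) ^ Suc k))"
    by (intro suminf_le U(4)) auto
  also have "\<dots> = (\<Sum>k. restricted_content D s (E k)) + (\<Sum>k. ennreal (e * (1/2) ^ Suc k))"
    by (rule suminf_add[symmetric]) auto
  also have "(\<Sum>k. ennreal (e * (1/2) ^ Suc k)) = ennreal e"
    using sums_mult[OF power_half_series, of e] \<open>0 < e\<close>
    by (intro sums_unique[symmetric] sums_ennreal[THEN iffD2]) auto
  finally show "restricted_content D s (\<Union>k. E k)
      \<le> (\<Sum>k. restricted_content D s (E k)) + ennreal e" .
qed

lemma sorgenfrey_scales_pos: "D \<in> sorgenfrey_scales \<Longrightarrow> t \<in> D \<Longrightarrow> 0 < t"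
  by (auto simp: sorgenfrey_scales_def)

lemma sorgenfrey_scales_small:
  assumes "D \<in> sorgenfrey_scales" "0 < e"
  shows "\<exists>t\<in>D. t < e"
  using assms cInf_lessD[of D e] by (auto simp: sorgenfrey_scales_def)

lemma sorgenfrey_scales_nonempty: "sorgenfrey_scales \<noteq> {}"
proof -
  have "{0<..} \<in> sorgenfrey_scales"
    by (auto simp: sorgenfrey_scales_def intro: exI[of _ 1])
  then show ?thesis by blast
qed

lemma sorgenfrey_scales_cheap:
  assumes D: "D \<in> sorgenfrey_scales" and s: "0 < s" and e: "0 < e"
  shows "\<exists>t\<in>D. t powr s \<le> e"
proof -
  have "0 < e powr (1/s)" using e by simp
  then obtain t where t: "t \<in> D" "t < e powr (1/s)"
    using sorgenfrey_scales_small[OF D] by blast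
  then have "t powr s \<le> (e powr (1/s)) powr s"
    using s sorgenfrey_scales_pos[OF D t(1)] by (intro powr_mono2) auto
  also have "\<dots> = e" using s e by (simp add: powr_powr)
  finally show ?thesis using t by blast
qed

text \<open>
  Covers are infinite sequences, so one ball has to be padded with further sets; scales of \<open>D\<close>
  close to \<open>0\<close> make the padding arbitrarily cheap, since \<open>s > 0\<close>.
\<close>

lemma restricted_content_cball_le:
  fixes x :: "'a::euclidean_space"
  assumes D: "D \<in> sorgenfrey_scales" and s: "0 < s" and t: "t \<in> D"
  shows "restricted_content D s (cball x (t/2)) \<le> ennreal (t powr s)"
proof (rule ennreal_le_epsilon)
  fix e :: real assume e: "0 < e"
  have "\<exists>u\<in>D. u powr s \<le> e * (1/2) ^ Suc i" for i
    by (rule sorgenfrey_scales_cheap[OF D s]) (use e in simp)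
  then obtain u where u: "\<And>i. u i \<in> D" "\<And>i. u i powr s \<le> e * (1/2) ^ Suc i"
    by metis
  define w where "w i = (if i = 0 then t else u i)" for i :: nat
  have w: "w i \<in> D" for i using t u(1) by (simp add: w_def)
  then have diam: "diameter (cball x (w i / 2)) = w i" for i
    using sorgenfrey_scales_pos[OF D, of "w i"] by (simp add: diameter_cball)
  have sums: "(\<lambda>i. (if i = 0 then t powr s else 0) + e * (1/2) ^ Suc i) sums (t powr s + e * 1)"
    by (intro sums_add sums_mult power_half_series sums_single)
  have "restricted_content D s (cball x (t/2))
      \<le> (\<Sum>i. ennreal (diameter (cball x (w i / 2)) powr s))"
    by (rule restricted_content_le) (use w diam in \<open>auto simp: w_def intro!: exI[of _ 0]\<close>)
  also have "\<dots> \<le> (\<Sum>i. ennreal ((if i = 0 then t powr s else 0) + e * (1/2) ^ Suc i))"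
    using u(2) e by (intro suminf_le ennreal_leI) (auto simp: diam w_def)
  also have "\<dots> = ennreal (t powr s + e * 1)"
    using sums e by (intro sums_unique[symmetric] sums_ennreal[THEN iffD2]) auto
  finally show "restricted_content D s (cball x (t/2)) \<le> ennreal (t powr s) + ennreal e"
    using e by simp
qed

lemma restricted_content_subsingleton:
  fixes x :: "'a::euclidean_space"
  assumes D: "D \<in> sorgenfrey_scales" and s: "0 < s" and E: "E \<subseteq> {x}"
  shows "restricted_content D s E = 0"
proof -
  have le: "restricted_content D s E \<le> 0 + ennreal e" if "0 < e" for e
  proof -
    obtain t where t: "t \<in> D" "t powr s \<le> e"
      using sorgenfrey_scales_cheap[OF D s \<open>0 < e\<close>] by blast
    have "0 < t" using sorgenfrey_scales_pos[OF D t(1)] .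
    then have "restricted_content D s E \<le> restricted_content D s (cball x (t/2))"
      using E by (intro restricted_content_mono) auto
    also have "\<dots> \<le> ennreal (t powr s)"
      by (rule restricted_content_cball_le[OF D s t(1)])
    also have "\<dots> \<le> ennreal e" using t(2) by (rule ennreal_leI)
    finally show ?thesis by simp
  qed
  have "restricted_content D s E \<le> 0"
    by (rule ennreal_le_epsilon) (rule le)
  then show ?thesis by simp
qed

lemma restricted_content_finite_UN_le:
  fixes P :: "'b set"
  assumes D: "D \<in> sorgenfrey_scales" and s: "0 < s" and P: "finite P"
  shows "restricted_content D s (\<Union>p\<in>P. E p) \<le> (\<Sum>p\<in>P. restricted_content D s (E p))"
proof -
  obtain h where h: "bij_betw h {..<card P} P"
    using ex_bij_betw_nat_finite[OF P] by (auto simp: lessThan_atLeast0)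
  define F where "F k = (if k < card P then E (h k) else {})" for k
  have "(\<Union>p\<in>P. E p) \<subseteq> (\<Union>k. F k)"
  proof (rule UN_least)
    fix p assume "p \<in> P"
    then have "p \<in> h ` {..<card P}"
      using bij_betw_imp_surj_on[OF h] by simp
    then obtain k where "k < card P" "h k = p" by auto
    then show "E p \<subseteq> (\<Union>k. F k)"
      by (auto simp: F_def split: if_splits)
  qed
  then have "restricted_content D s (\<Union>p\<in>P. E p) \<le> restricted_content D s (\<Union>k. F k)"
    by (rule restricted_content_mono)
  also have "\<dots> \<le> (\<Sum>k. restricted_content D s (F k))"
    by (rule restricted_content_UN_le)
  also have "\<dots> = (\<Sum>k<card P. restricted_content D s (F k))"
    by (intro suminf_finite) (auto simp: F_def restricted_content_subsingleton[OF D s])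
  also have "\<dots> = (\<Sum>k<card P. restricted_content D s (E (h k)))"
    by (simp add: F_def)
  also have "\<dots> = (\<Sum>p\<in>P. restricted_content D s (E p))"
    by (rule sum.reindex_bij_betw[OF h])
  finally show ?thesis .
qed

lemma restricted_content_Un_le:
  assumes D: "D \<in> sorgenfrey_scales" and s: "0 < s"
  shows "restricted_content D s (E \<union> F) \<le> restricted_content D s E + restricted_content D s F"
  using restricted_content_finite_UN_le[OF D s, of "{True, False}" "\<lambda>b. if b then E else F"]
  by (simp add: Un_commute)

section \<open>Volumes of balls\<close>

lemma emeasure_cball_sum:
  fixes x :: "'i \<Rightarrow> 'a::euclidean_space"
  assumes "\<And>i. i \<in> F \<Longrightarrow> 0 \<le> r i"
  shows "(\<Sum>i\<in>F. emeasure lborel (cball (x i) (r i)))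
    = ennreal (unit_ball_vol DIM('a) * (\<Sum>i\<in>F. r i ^ DIM('a)))"
  using assms by (simp add: emeasure_cball sum_distrib_left sum_ennreal)

lemma sum_radii_power_le_disjoint:
  fixes x :: "'i \<Rightarrow> 'a::euclidean_space"
  assumes "finite F" "\<And>i. i \<in> F \<Longrightarrow> 0 \<le> r i" "0 \<le> R"
    and disj: "disjoint_family_on (\<lambda>i. cball (x i) (r i)) F"
    and sub: "\<And>i. i \<in> F \<Longrightarrow> cball (x i) (r i) \<subseteq> cball c R"
  shows "(\<Sum>i\<in>F. r i ^ DIM('a)) \<le> R ^ DIM('a)"
proof -
  have "(\<Sum>i\<in>F. emeasure lborel (cball (x i) (r i)))
      = emeasure lborel (\<Union>i\<in>F. cball (x i) (r i))"
    using assms(1) disj by (intro sum_emeasure) auto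
  also have "\<dots> \<le> emeasure lborel (cball c R)"
    using sub by (intro emeasure_mono) auto
  finally have "ennreal (unit_ball_vol DIM('a) * (\<Sum>i\<in>F. r i ^ DIM('a)))
      \<le> ennreal (unit_ball_vol DIM('a) * R ^ DIM('a))"
    by (simp only: emeasure_cball_sum[OF assms(2)] emeasure_cball[OF assms(3)])
  then show ?thesis using assms(3) by (simp add: ennreal_le_iff)
qed

text \<open>
  Volume subadditivity, with the volume of the unit ball cancelled. This is the only source of lower
  bounds on covers.
\<close>

lemma power_radius_le_sum_cover:
  fixes x :: "'i \<Rightarrow> 'a::euclidean_space"
  assumes "finite F" "\<And>i. i \<in> F \<Longrightarrow> 0 \<le> r i" "0 \<le> R"
    and cover: "cball c R \<subseteq> (\<Union>i\<in>F. cball (x i) (r i))"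
  shows "R ^ DIM('a) \<le> (\<Sum>i\<in>F. r i ^ DIM('a))"
proof -
  have "emeasure lborel (cball c R) \<le> emeasure lborel (\<Union>i\<in>F. cball (x i) (r i))"
    using cover assms(1) by (intro emeasure_mono) auto
  also have "\<dots> \<le> (\<Sum>i\<in>F. emeasure lborel (cball (x i) (r i)))"
    using assms(1) by (intro emeasure_subadditive_finite) auto
  finally have "ennreal (unit_ball_vol DIM('a) * R ^ DIM('a))
      \<le> ennreal (unit_ball_vol DIM('a) * (\<Sum>i\<in>F. r i ^ DIM('a)))"
    by (simp only: emeasure_cball_sum[OF assms(2)] emeasure_cball[OF assms(3)])
  then show ?thesis using assms(2) by (simp add: ennreal_le_iff sum_nonneg)
qed

section \<open>Packing and intermediate dimensions\<close>

lemma packing_premeasure_mono: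
  assumes "E \<subseteq> F"
  shows "packing_premeasure s E \<le> packing_premeasure s F"
  unfolding packing_premeasure_def packing_delta_def
proof (rule INF_mono)
  fix \<delta> :: real assume "\<delta> \<in> {0<..}"
  show "\<exists>\<delta>'\<in>{0<..}.
      Sup {(\<Sum>\<^sub>\<infinity>i\<in>I. ennreal (diameter (cball (x i) (r i)) powr s)) |
           (I :: nat set) (x :: nat \<Rightarrow> 'a) (r :: nat \<Rightarrow> real).
           (\<forall>i\<in>I. x i \<in> E \<and> 0 < r i \<and> r i \<le> \<delta>') \<and>
           disjoint_family_on (\<lambda>i. cball (x i) (r i)) I}
      \<le> Sup {(\<Sum>\<^sub>\<infinity>i\<in>I. ennreal (diameter (cball (x i) (r i)) powr s)) |
           (I :: nat set) (x :: nat \<Rightarrow> 'a) (r :: nat \<Rightarrow> real).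
           (\<forall>i\<in>I. x i \<in> F \<and> 0 < r i \<and> r i \<le> \<delta>) \<and>
           disjoint_family_on (\<lambda>i. cball (x i) (r i)) I}"
    using assms \<open>\<delta> \<in> {0<..}\<close> by (intro bexI[of _ \<delta>] Sup_subset_mono) blast+
qed

text \<open>
  Equal balls, the only packings needed for lower bounds on the packing premeasure.
\<close>

lemma card_le_packing_delta:
  fixes S :: "'a::euclidean_space set"
  assumes "finite S" "S \<subseteq> E" "disjoint_family_on (\<lambda>x. cball x r) S" "0 < r" "r \<le> \<delta>"
  shows "ennreal (card S * (2 * r) powr s) \<le> packing_delta s \<delta> E"
proof -
  obtain h where h: "bij_betw h {..<card S} S"
    using ex_bij_betw_nat_finite[OF assms(1)] by (auto simp: lessThan_atLeast0)
  have hS: "h i \<in> S" if "i < card S" for i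
    using h that by (auto dest: bij_betwE)
  have disj: "disjoint_family_on (\<lambda>i. cball (h i) r) {..<card S}"
    unfolding disjoint_family_on_def
  proof (intro ballI impI)
    fix i j assume ij: "i \<in> {..<card S}" "j \<in> {..<card S}" "i \<noteq> j"
    then have "h i \<noteq> h j"
      using h by (auto simp: bij_betw_def dest: inj_onD)
    then show "cball (h i) r \<inter> cball (h j) r = {}"
      using assms(3) hS ij by (auto simp: disjoint_family_on_def)
  qed
  have "ennreal (card S * (2 * r) powr s)
      = (\<Sum>\<^sub>\<infinity>i\<in>{..<card S}. ennreal (diameter (cball (h i) r) powr s))"
    using assms(4) by (simp add: ennreal_mult ennreal_of_nat_eq_real_of_nat)
  also have "\<dots> \<le> packing_delta s \<delta> E"
    unfolding packing_delta_def
  proof (rule Sup_upper, rule CollectI, intro exI conjI)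
    show "\<forall>i\<in>{..<card S}. h i \<in> E \<and> 0 < r \<and> r \<le> \<delta>"
      using assms hS by blast
  qed (rule refl, rule disj)
  finally show ?thesis .
qed

text \<open>
  A packing of maximal cardinality cannot be enlarged, so every ball of radius \<open>r\<close> centred in \<open>E\<close>
  meets one of its members.
\<close>

lemma maximal_packing_covers:
  fixes E :: "'a::real_normed_vector set"
  assumes "0 \<le> r"
    and bound: "\<And>S. finite S \<Longrightarrow> S \<subseteq> E \<Longrightarrow> disjoint_family_on (\<lambda>x. cball x r) S \<Longrightarrow> card S \<le> M"
  obtains S where "finite S" "S \<subseteq> E" "disjoint_family_on (\<lambda>x. cball x r) S"
    "E \<subseteq> (\<Union>x\<in>S. cball x (2 * r))"
proof -
  let ?P = "\<lambda>S. finite S \<and> S \<subseteq> E \<and> disjoint_family_on (\<lambda>x. cball x r) S"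
  have "\<exists>S. ?P S \<and> (\<forall>T. ?P T \<longrightarrow> card T \<le> card S)"
  proof (rule ex_has_greatest_nat)
    show "?P {}" by (simp add: disjoint_family_on_def)
    show "\<forall>S. ?P S \<longrightarrow> card S < Suc M" using bound by (simp add: less_Suc_eq_le)
  qed
  then obtain S where S: "?P S" and max: "\<And>T. ?P T \<Longrightarrow> card T \<le> card S"
    by (elim exE conjE) auto
  have "E \<subseteq> (\<Union>x\<in>S. cball x (2 * r))"
  proof
    fix y assume y: "y \<in> E"
    show "y \<in> (\<Union>x\<in>S. cball x (2 * r))"
    proof (rule ccontr)
      assume far: "y \<notin> (\<Union>x\<in>S. cball x (2 * r))"
      have apart: "cball x r \<inter> cball y r = {}" if "x \<in> S" for x
      proof (rule ccontr)
        assume "cball x r \<inter> cball y r \<noteq> {}"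
        then obtain z where "dist x z \<le> r" "dist y z \<le> r" by auto
        then have "dist x y \<le> 2 * r"
          using dist_triangle2[of x y z] by simp
        with far that show False by auto
      qed
      have "y \<notin> S"
      proof
        assume "y \<in> S"
        with apart[of y] \<open>0 \<le> r\<close> show False by simp
      qed
      moreover have "?P (insert y S)"
        using S y apart unfolding disjoint_family_on_def by (simp add: Int_commute)
      ultimately show False
        using max[of "insert y S"] S by simp
    qed
  qed
  with S that show thesis by blast
qed

lemma admissible_pos: "admissible \<Phi> \<Longrightarrow> 0 < \<delta> \<Longrightarrow> 0 < \<Phi> \<delta>"
  and admissible_le: "admissible \<Phi> \<Longrightarrow> 0 < \<delta> \<Longrightarrow> \<Phi> \<delta> \<le> \<delta>"
  by (auto simp: admissible_def)

text \<open>
  Finiteness of the premeasure bounds the cardinality of packings by balls of radius \<open>\<delta> / 4\<close> by a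
  constant times \<open>\<delta> powr - s\<close>. A maximal one gives a cover by as many sets of diameter exactly \<open>\<delta>\<close>,
  which is allowed since \<open>\<Phi> \<delta> \<le> \<delta>\<close>, and its cost at an exponent above \<open>s\<close> tends to \<open>0\<close>.
\<close>

lemma upper_intermediate_dim_le_of_packing_premeasure:
  fixes E :: "'a::euclidean_space set"
  assumes \<Phi>: "admissible \<Phi>" and s: "0 \<le> s" and fin: "packing_premeasure s E < top"
  shows "upper_intermediate_dim \<Phi> E \<le> ereal s"
proof (rule ereal_le_epsilon2)
  fix e :: real assume e: "0 < e"
  obtain \<delta>1 where \<delta>1: "0 < \<delta>1" "packing_delta s \<delta>1 E < top"
    using fin by (auto simp: packing_premeasure_def INF_less_iff)
  then obtain c where c: "0 \<le> c" "packing_delta s \<delta>1 E = ennreal c"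
    using less_top_ennreal by blast
  define C where "C = c * 2 powr s + 1"
  have C: "0 < C" "c * 2 powr s \<le> C"
    using c by (auto simp: C_def add_nonneg_pos)
  have "\<exists>\<delta>\<^sub>0>0. \<forall>\<delta>\<in>{0<..<\<delta>\<^sub>0}. \<exists>(I :: nat set) (U :: nat \<Rightarrow> 'a set).
         E \<subseteq> (\<Union>i\<in>I. U i) \<and>
         (\<forall>i\<in>I. bounded (U i) \<and> \<Phi> \<delta> \<le> diameter (U i) \<and> diameter (U i) \<le> \<delta>) \<and>
         (\<Sum>\<^sub>\<infinity>i\<in>I. ennreal (diameter (U i) powr (s + e))) \<le> ennreal \<epsilon>" if "0 < \<epsilon>" for \<epsilon>
  proof (rule exI[of _ "min \<delta>1 ((\<epsilon> / C) powr (1/e))"], intro conjI ballI)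
    show "0 < min \<delta>1 ((\<epsilon> / C) powr (1/e))" using \<delta>1 C that by simp
    fix \<delta> assume "\<delta> \<in> {0<..<min \<delta>1 ((\<epsilon> / C) powr (1/e))}"
    then have \<delta>: "0 < \<delta>" "\<delta> < \<delta>1" "\<delta> < (\<epsilon> / C) powr (1/e)" by auto
    have card_le: "card S * (\<delta>/2) powr s \<le> c"
      if "finite S" "S \<subseteq> E" "disjoint_family_on (\<lambda>x. cball x (\<delta>/4)) S" for S
      using card_le_packing_delta[OF that, of \<delta>1 s] \<delta> c by (simp add: ennreal_le_iff)
    have card_bound: "card S \<le> nat \<lceil>c / (\<delta>/2) powr s\<rceil>"
      if "finite S" "S \<subseteq> E" "disjoint_family_on (\<lambda>x. cball x (\<delta>/4)) S" for S
      using card_le[OF that] \<delta> by (simp add: pos_le_divide_eq[symmetric]) linarith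
    have "0 \<le> \<delta>/4" using \<delta> by simp
    then obtain S where S: "finite S" "S \<subseteq> E" "disjoint_family_on (\<lambda>x. cball x (\<delta>/4)) S"
      "E \<subseteq> (\<Union>x\<in>S. cball x (2 * (\<delta>/4)))"
      by (rule maximal_packing_covers[OF _ card_bound])
    obtain h where h: "bij_betw h {..<card S} S"
      using ex_bij_betw_nat_finite[OF S(1)] by (auto simp: lessThan_atLeast0)
    have cover: "E \<subseteq> (\<Union>i\<in>{..<card S}. cball (h i) (\<delta>/2))"
      using S(4) by (subst (asm) bij_betw_imp_surj_on[OF h, symmetric]) simp
    have "card S * \<delta> powr (s + e) = card S * (\<delta>/2) powr s * 2 powr s * \<delta> powr e"
      using \<delta> by (simp add: powr_add powr_divide)
    also have "\<dots> \<le> c * 2 powr s * \<delta> powr e"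
      using card_le[OF S(1-3)] by (intro mult_right_mono) auto
    also have "\<dots> \<le> C * ((\<epsilon> / C) powr (1/e)) powr e"
      using C \<delta> e by (intro mult_mono powr_mono2) auto
    also have "\<dots> = \<epsilon>" using C e that by (simp add: powr_powr)
    finally have sum: "card S * \<delta> powr (s + e) \<le> \<epsilon>" .
    show "\<exists>(I :: nat set) (U :: nat \<Rightarrow> 'a set).
         E \<subseteq> (\<Union>i\<in>I. U i) \<and>
         (\<forall>i\<in>I. bounded (U i) \<and> \<Phi> \<delta> \<le> diameter (U i) \<and> diameter (U i) \<le> \<delta>) \<and>
         (\<Sum>\<^sub>\<infinity>i\<in>I. ennreal (diameter (U i) powr (s + e))) \<le> ennreal \<epsilon>"
    proof (intro exI conjI)
      show "E \<subseteq> (\<Union>i\<in>{..<card S}. cball (h i) (\<delta>/2))" by (rule cover)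
      show "\<forall>i\<in>{..<card S}. bounded (cball (h i) (\<delta>/2)) \<and>
          \<Phi> \<delta> \<le> diameter (cball (h i) (\<delta>/2)) \<and> diameter (cball (h i) (\<delta>/2)) \<le> \<delta>"
        using \<delta> admissible_le[OF \<Phi>, of \<delta>] by simp
      have "(\<Sum>\<^sub>\<infinity>i\<in>{..<card S}. ennreal (diameter (cball (h i) (\<delta>/2)) powr (s + e)))
          = ennreal (card S * \<delta> powr (s + e))"
        using \<delta> by (simp add: ennreal_mult ennreal_of_nat_eq_real_of_nat)
      also have "\<dots> \<le> ennreal \<epsilon>" using sum by (rule ennreal_leI)
      finally show "(\<Sum>\<^sub>\<infinity>i\<in>{..<card S}. ennreal (diameter (cball (h i) (\<delta>/2)) powr (s + e)))
          \<le> ennreal \<epsilon>" .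
    qed
  qed
  then have "upper_intermediate_dim \<Phi> E \<le> ereal (s + e)"
    unfolding upper_intermediate_dim_def using s e
    by (intro Inf_lower CollectI exI[of _ "s + e"]) auto
  then show "upper_intermediate_dim \<Phi> E \<le> ereal s + ereal e" by simp
qed

lemma modified_upper_intermediate_dim_le_packing_dim:
  fixes E :: "'a::euclidean_space set"
  assumes \<Phi>: "admissible \<Phi>" and "bounded E"
  shows "modified_upper_intermediate_dim \<Phi> E \<le> packing_dim E"
  unfolding packing_dim_def
proof (rule Inf_greatest, clarify)
  fix s :: real assume s: "0 \<le> s" and "packing_measure s E = 0"
  then have "packing_measure s E < 1" by simp
  then obtain Y :: "nat \<Rightarrow> 'a set" where
    Y: "E \<subseteq> (\<Union>i. Y i)" "(\<Sum>i. packing_premeasure s (Y i)) < 1"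
    unfolding packing_measure_def Inf_less_iff by blast
  have "packing_premeasure s (Y i \<inter> E) < top" for i
    using packing_premeasure_mono[of "Y i \<inter> E" "Y i" s] ennreal_suminf_lessD[OF Y(2), of i]
    by (auto intro: le_less_trans less_trans)
  then have le: "upper_intermediate_dim \<Phi> (Y i \<inter> E) \<le> ereal s" for i
    using upper_intermediate_dim_le_of_packing_premeasure[OF \<Phi> s] by blast
  have "modified_upper_intermediate_dim \<Phi> E \<le> (SUP i. upper_intermediate_dim \<Phi> (Y i \<inter> E))"
    unfolding modified_upper_intermediate_dim_def
    using Y(1) \<open>bounded E\<close>
    by (intro Inf_lower CollectI exI[of _ "\<lambda>i. Y i \<inter> E"]) auto
  also have "\<dots> \<le> ereal s" by (rule SUP_least) (rule le)
  finally show "modified_upper_intermediate_dim \<Phi> E \<le> ereal s" .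
qed

text \<open>
  Disjoint balls in a bounded region have bounded total volume; the surplus \<open>s - DIM('a)\<close> in the
  exponent turns this into a factor that vanishes with \<open>\<delta>\<close>.
\<close>

lemma packing_delta_le:
  fixes E :: "'a::euclidean_space set"
  assumes E: "E \<subseteq> cball 0 R" and R: "0 \<le> R" and s: "real DIM('a) < s"
    and \<delta>: "0 < \<delta>" "\<delta> \<le> 1"
  shows "packing_delta s \<delta> E
    \<le> ennreal (2 powr s * (R + 1) ^ DIM('a) * \<delta> powr (s - DIM('a)))"
  unfolding packing_delta_def
proof (rule Sup_least, clarify)
  fix I :: "nat set" and x :: "nat \<Rightarrow> 'a" and r :: "nat \<Rightarrow> real"
  assume r: "\<forall>i\<in>I. x i \<in> E \<and> 0 < r i \<and> r i \<le> \<delta>"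
    and disj: "disjoint_family_on (\<lambda>i. cball (x i) (r i)) I"
  show "(\<Sum>\<^sub>\<infinity>i\<in>I. ennreal (diameter (cball (x i) (r i)) powr s))
    \<le> ennreal (2 powr s * (R + 1) ^ DIM('a) * \<delta> powr (s - DIM('a)))"
    unfolding nonneg_infsum_complete[OF zero_le]
  proof (rule SUP_least, clarify)
    fix F assume F: "finite F" "F \<subseteq> I"
    have rF: "x i \<in> E" "0 < r i" "r i \<le> \<delta>" if "i \<in> F" for i using r F that by auto
    have term_le: "diameter (cball (x i) (r i)) powr s
        \<le> 2 powr s * \<delta> powr (s - DIM('a)) * r i ^ DIM('a)" if "i \<in> F" for i
    proof -
      have "diameter (cball (x i) (r i)) powr s = 2 powr s * (r i powr (s - DIM('a)) * r i powr DIM('a))"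
        using rF[OF that] by (simp add: powr_mult powr_add[symmetric])
      also have "\<dots> \<le> 2 powr s * (\<delta> powr (s - DIM('a)) * r i powr DIM('a))"
        using rF[OF that] s by (intro mult_left_mono mult_right_mono powr_mono2) auto
      finally show ?thesis using rF[OF that] by (simp add: powr_realpow mult.assoc)
    qed
    have "cball (x i) (r i) \<subseteq> cball 0 (R + 1)" if "i \<in> F" for i
    proof
      fix y assume "y \<in> cball (x i) (r i)"
      then have "dist (x i) y \<le> 1" using rF[OF that] \<delta> by simp
      moreover have "dist 0 (x i) \<le> R" using rF[OF that] E by auto
      ultimately show "y \<in> cball 0 (R + 1)"
        using dist_triangle[of 0 y "x i"] by simp
    qed
    then have "(\<Sum>i\<in>F. r i ^ DIM('a)) \<le> (R + 1) ^ DIM('a)"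
      using F disj rF R
      by (intro sum_radii_power_le_disjoint[where x = x and c = 0])
        (auto intro: less_imp_le disjoint_family_on_mono)
    then have "(\<Sum>i\<in>F. diameter (cball (x i) (r i)) powr s)
        \<le> 2 powr s * \<delta> powr (s - DIM('a)) * (R + 1) ^ DIM('a)"
      by (intro order.trans[OF sum_mono[OF term_le]])
        (auto simp: sum_distrib_left[symmetric] intro!: mult_left_mono)
    then show "(\<Sum>i\<in>F. ennreal (diameter (cball (x i) (r i)) powr s))
      \<le> ennreal (2 powr s * (R + 1) ^ DIM('a) * \<delta> powr (s - DIM('a)))"
      by (simp add: sum_ennreal ennreal_leI mult_ac)
  qed
qed

lemma packing_dim_le_DIM:
  fixes E :: "'a::euclidean_space set"
  assumes "bounded E"
  shows "packing_dim E \<le> ereal (real DIM('a))"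
proof (rule ereal_le_epsilon2)
  fix e :: real assume e: "0 < e"
  define s where "s = real DIM('a) + e"
  obtain R where R: "0 < R" "E \<subseteq> cball 0 R"
    using bounded_subset_ballD[OF assms, of 0] ball_subset_cball by blast
  define C where "C = 2 powr s * (R + 1) ^ DIM('a)"
  have C: "0 < C" using R by (simp add: C_def)
  have premeasure_le: "packing_premeasure s E \<le> 0 + ennreal \<epsilon>" if "0 < \<epsilon>" for \<epsilon>
  proof -
    define \<delta> where "\<delta> = min 1 ((\<epsilon> / C) powr (1/e))"
    have \<delta>: "0 < \<delta>" "\<delta> \<le> 1" "\<delta> \<le> (\<epsilon> / C) powr (1/e)" using C that by (auto simp: \<delta>_def)
    have "packing_premeasure s E \<le> packing_delta s \<delta> E"
      unfolding packing_premeasure_def using \<delta> by (intro INF_lower) auto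
    also have "\<dots> \<le> ennreal (C * \<delta> powr e)"
      using packing_delta_le[of E R s \<delta>] R e \<delta> by (simp add: s_def C_def)
    also have "C * \<delta> powr e \<le> C * ((\<epsilon> / C) powr (1/e)) powr e"
      using C \<delta> e by (intro mult_left_mono powr_mono2) auto
    also have "\<dots> = \<epsilon>" using C e that by (simp add: powr_powr)
    finally show ?thesis by (simp add: ennreal_leI)
  qed
  have "packing_premeasure s E \<le> 0"
    by (rule ennreal_le_epsilon) (rule premeasure_le)
  then have "packing_measure s E \<le> (\<Sum>i::nat. 0)"
    unfolding packing_measure_def
    by (intro Inf_lower CollectI exI[of _ "\<lambda>_. E"]) auto
  then show "packing_dim E \<le> ereal (real DIM('a)) + ereal e"
    unfolding packing_dim_def using e
    by (intro Inf_lower CollectI exI[of _ s]) (auto simp: s_def)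
qed

section \<open>The cluster construction\<close>

text \<open>
  Baire's theorem in covering form. The pieces \<open>Y i\<close> need not be closed, which is why the conclusion
  is about their closures.
\<close>

lemma closed_UN_somewhere_dense:
  fixes K :: "'a::euclidean_space set"
  assumes "closed K" "K \<noteq> {}" and K: "K \<subseteq> (\<Union>i::nat. Y i)"
  obtains i V where "open V" "V \<inter> K \<noteq> {}" "V \<inter> K \<subseteq> closure (Y i)"
proof (rule ccontr)
  assume "\<not> thesis"
  then have nowhere: "\<not> V \<inter> K \<subseteq> closure (Y i)" if "open V" "V \<inter> K \<noteq> {}" for V i
    using that \<open>\<And>V i. \<lbrakk>open V; V \<inter> K \<noteq> {}; V \<inter> K \<subseteq> closure (Y i)\<rbrakk> \<Longrightarrow> thesis\<close> by blast
  have dense: "K \<subseteq> closure (K - closure (Y i))" for i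
  proof (rule ccontr)
    let ?V = "- closure (K - closure (Y i))"
    assume "\<not> K \<subseteq> closure (K - closure (Y i))"
    then have "?V \<inter> K \<noteq> {}" by blast
    then have "\<not> ?V \<inter> K \<subseteq> closure (Y i)" by (intro nowhere) auto
    then show False using closure_subset[of "K - closure (Y i)"] by blast
  qed
  have "openin (top_of_set K) (K - closure (Y i))" for i
    by (simp add: Diff_eq openin_open_Int open_Compl)
  with dense have baire: "K \<subseteq> closure (\<Inter>(range (\<lambda>i. K - closure (Y i))))"
    using \<open>closed K\<close> by (intro Baire) auto
  have "x \<notin> \<Inter>(range (\<lambda>i. K - closure (Y i)))" for x
  proof
    assume x: "x \<in> \<Inter>(range (\<lambda>i. K - closure (Y i)))"
    then obtain i where "x \<in> Y i" using K by blast
    then have "x \<in> closure (Y i)" using closure_subset by blast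
    with x show False by blast
  qed
  then have "\<Inter>(range (\<lambda>i. K - closure (Y i))) = {}" by blast
  with baire \<open>K \<noteq> {}\<close> show False by (simp only: closure_empty subset_empty)
qed

text \<open>
  The construction as a list of properties. The points \<open>q m\<close> run through a dense sequence that returns
  to every open set, and \<open>v m\<close> is a point of \<open>P m\<close> nearest to \<open>q m\<close>; this makes the selected points
  visit every part of the limit set infinitely often. The assumption \<open>cheap\<close> is responsible for
  dimension \<open>0\<close>, and \<open>\<delta>_small\<close> together with \<open>net\<close> for dimension \<open>DIM('a)\<close>. In both, the exponent
  \<open>1 / Suc m\<close> tends to \<open>0\<close>, so that every fixed positive exponent is eventually dominated.
\<close>

locale cluster_scheme =
  fixes \<Phi> :: "real \<Rightarrow> real" and q :: "nat \<Rightarrow> 'a::euclidean_space"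
    and P :: "nat \<Rightarrow> 'a set" and v :: "nat \<Rightarrow> 'a" and \<rho> \<delta> :: "nat \<Rightarrow> real"
  assumes \<Phi>: "admissible \<Phi>"
    and q_dense: "\<And>V. open V \<Longrightarrow> V \<noteq> {} \<Longrightarrow> infinite {m. q m \<in> V}"
    and finite_P: "\<And>m. finite (P m)"
    and v_in: "\<And>m. v m \<in> P m"
    and v_nearest: "\<And>m p. p \<in> P m \<Longrightarrow> dist (v m) (q m) \<le> dist p (q m)"
    and P_subset_Suc: "\<And>m. P m \<subseteq> P (Suc m)"
    and P_Suc_subset: "\<And>m. P (Suc m) \<subseteq> P m \<union> cball (v m) (\<rho> m / 2)"
    and \<rho>_pos: "\<And>m. 0 < \<rho> m"
    and \<rho>_le: "\<And>m. \<rho> m \<le> (1/2) ^ Suc m"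
    and \<rho>_Suc_le: "\<And>m. \<rho> (Suc m) \<le> \<rho> m / 2"
    and cheap: "\<And>m. card (P m) * (2 * \<rho> m) powr (1 / Suc m) \<le> (1/2) ^ m"
    and \<delta>_pos: "\<And>m. 0 < \<delta> m"
    and \<delta>_le: "\<And>m. \<delta> m \<le> \<rho> m / 2"
    and \<delta>_small: "\<And>m. \<delta> m powr (1 / Suc m) < (\<rho> m / 4) ^ DIM('a)"
    and net: "\<And>m. cball (v m) (\<rho> m / 2) \<subseteq> (\<Union>g\<in>P (Suc m). ball g (\<Phi> (\<delta> m)))"
begin

definition K :: "'a set" where "K = closure (\<Union>m. P m)"

lemma P_mono: "m \<le> k \<Longrightarrow> P m \<subseteq> P k"
  by (rule lift_Suc_mono_le[of P]) (rule P_subset_Suc)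

lemma P_subset_K: "P m \<subseteq> K"
  unfolding K_def using closure_subset[of "\<Union>m. P m"] by blast

lemma \<rho>_antimono: "m \<le> k \<Longrightarrow> \<rho> k \<le> \<rho> m"
  by (rule lift_Suc_antimono_le[of \<rho>]) (use \<rho>_pos \<rho>_Suc_le in \<open>smt (verit) field_sum_of_halves\<close>)

lemma \<rho>_eventually_less:
  assumes "0 < e"
  shows "\<exists>M. \<forall>m\<ge>M. \<rho> m < e"
proof -
  obtain M where "(1/2::real) ^ M < e"
    using real_arch_pow_inv[OF assms, of "1/2"] by auto
  moreover have "\<rho> m \<le> (1/2) ^ M" if "M \<le> m" for m
  proof -
    have "\<rho> m \<le> (1/2) ^ Suc m" by (rule \<rho>_le)
    also have "\<dots> \<le> (1/2) ^ M" using that by (intro power_decreasing) auto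
    finally show ?thesis .
  qed
  ultimately show ?thesis by (meson le_less_trans)
qed

lemma cball_Suc_subset:
  assumes "p \<in> P (Suc m) - P m"
  shows "cball p (\<rho> (Suc m)) \<subseteq> cball (v m) (\<rho> m)"
proof
  fix x assume "x \<in> cball p (\<rho> (Suc m))"
  then have "dist p x \<le> \<rho> m / 2" using \<rho>_Suc_le[of m] by auto
  moreover have "dist (v m) p \<le> \<rho> m / 2" using assms P_Suc_subset[of m] by auto
  ultimately show "x \<in> cball (v m) (\<rho> m)"
    using dist_triangle[of "v m" x p] by simp
qed

text \<open>
  The argument runs downwards from \<open>k\<close> to \<open>m\<close>: halving the radii and placing new points within
  \<open>\<rho> m / 2\<close> of \<open>v m\<close> makes the unions of balls decrease from stage to stage.
\<close>

lemma P_subset_cballs: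
  assumes "m \<le> k"
  shows "P k \<subseteq> (\<Union>p\<in>P m. cball p (\<rho> m))"
  using assms
proof (induction rule: inc_induct)
  case base
  show ?case using \<rho>_pos[of k] by (auto intro!: bexI)
next
  case (step m)
  have "cball p (\<rho> (Suc m)) \<subseteq> (\<Union>p\<in>P m. cball p (\<rho> m))" if "p \<in> P (Suc m)" for p
  proof (cases "p \<in> P m")
    case True
    then show ?thesis using \<rho>_antimono[of m "Suc m"] by fastforce
  next
    case False
    then show ?thesis using cball_Suc_subset[of p m] v_in[of m] that by blast
  qed
  with step.IH show ?case by blast
qed

lemma K_subset_cballs: "K \<subseteq> (\<Union>p\<in>P m. cball p (\<rho> m))"
  unfolding K_def
proof (rule closure_minimal)
  show "(\<Union>k. P k) \<subseteq> (\<Union>p\<in>P m. cball p (\<rho> m))"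
  proof (rule UN_least)
    fix k
    show "P k \<subseteq> (\<Union>p\<in>P m. cball p (\<rho> m))"
      using P_subset_cballs[of m "max m k"] P_mono[of k "max m k"] by auto
  qed
  show "closed (\<Union>p\<in>P m. cball p (\<rho> m))"
    by (intro closed_UN finite_P) auto
qed

lemma compact_K: "compact K"
proof -
  have "bounded (\<Union>p\<in>P 0. cball p (\<rho> 0))"
    by (intro bounded_UN finite_P) auto
  then show ?thesis
    using bounded_subset[OF _ K_subset_cballs] by (auto simp: compact_eq_bounded_closed K_def)
qed

text \<open>
  The points added at stage \<open>m\<close> and everything that grows around them later lie in the ball around
  \<open>v m\<close>. Outside it only the old points matter, now with the next radius.
\<close>

lemma K_minus_cball_subset: "K - cball (v m) (\<rho> m) \<subseteq> (\<Union>p\<in>P m. cball p (\<rho> (Suc m)))"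
proof
  fix x assume x: "x \<in> K - cball (v m) (\<rho> m)"
  then obtain p where p: "p \<in> P (Suc m)" "x \<in> cball p (\<rho> (Suc m))"
    using K_subset_cballs[of "Suc m"] by blast
  then have "p \<in> P m"
    using cball_Suc_subset[of p m] x by blast
  with p show "x \<in> (\<Union>p\<in>P m. cball p (\<rho> (Suc m)))" by blast
qed

section \<open>The universal dimension of the limit set\<close>

definition hits :: "real set \<Rightarrow> nat \<Rightarrow> bool" where
  "hits D m \<longleftrightarrow> (\<exists>t\<in>D. 2 * \<rho> (Suc m) \<le> t \<and> t < 2 * \<rho> m)"

text \<open>
  The windows \<open>[2 * \<rho> (Suc m), 2 * \<rho> m)\<close> with \<open>m \<ge> M\<close> tile the interval \<open>(0, 2 * \<rho> M)\<close>, which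
  contains an element of \<open>D\<close>.
\<close>

lemma frequently_hits:
  assumes D: "D \<in> sorgenfrey_scales"
  shows "\<exists>m\<ge>M. hits D m"
proof -
  obtain t where t: "t \<in> D" "t < 2 * \<rho> M"
    using sorgenfrey_scales_small[OF D, of "2 * \<rho> M"] \<rho>_pos[of M] by auto
  define k where "k = (LEAST k. 2 * \<rho> k \<le> t)"
  obtain N where "\<rho> N < t / 2"
    using \<rho>_eventually_less[of "t/2"] sorgenfrey_scales_pos[OF D t(1)] by auto
  then have "2 * \<rho> N \<le> t" by simp
  then have k: "2 * \<rho> k \<le> t" unfolding k_def by (rule LeastI)
  have "M < k"
    using k t \<rho>_antimono[of k M] by (cases "k \<le> M") auto
  then obtain m where m: "k = Suc m" "M \<le> m" by (cases k) auto
  have "\<not> 2 * \<rho> m \<le> t"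
    by (rule not_less_Least) (use m in \<open>simp add: k_def\<close>)
  then show ?thesis using t k m by (auto simp: hits_def intro!: exI[of _ m] bexI[of _ t])
qed

lemma content_K_minus_cball_le:
  assumes D: "D \<in> sorgenfrey_scales" and m: "hits D m" and s: "1 / Suc m \<le> s"
  shows "restricted_content D s (K - cball (v m) (\<rho> m)) \<le> ennreal ((1/2) ^ m)"
proof -
  have s0: "0 < s" using s by (rule order.strict_trans2[rotated]) simp
  obtain t where t: "t \<in> D" "2 * \<rho> (Suc m) \<le> t" "t < 2 * \<rho> m"
    using m by (auto simp: hits_def)
  have "0 < t" using sorgenfrey_scales_pos[OF D t(1)] .
  have "2 * \<rho> m \<le> 1" using \<rho>_le[of m] power_le_one[of "1/2::real" m] by simp
  have "restricted_content D s (K - cball (v m) (\<rho> m))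
      \<le> restricted_content D s (\<Union>p\<in>P m. cball p (t/2))"
    using t(2)
    by (intro restricted_content_mono order.trans[OF K_minus_cball_subset] UN_mono) auto
  also have "\<dots> \<le> (\<Sum>p\<in>P m. restricted_content D s (cball p (t/2)))"
    by (rule restricted_content_finite_UN_le[OF D s0 finite_P])
  also have "\<dots> \<le> (\<Sum>p\<in>P m. ennreal (t powr s))"
    by (intro sum_mono restricted_content_cball_le[OF D s0 t(1)])
  also have "\<dots> = ennreal (card (P m) * t powr s)"
    by (simp add: ennreal_mult ennreal_of_nat_eq_real_of_nat)
  also have "\<dots> \<le> ennreal (card (P m) * (2 * \<rho> m) powr (1 / Suc m))"
  proof (intro ennreal_leI mult_left_mono)
    have "t powr s \<le> t powr (1 / Suc m)"
      using s \<open>0 < t\<close> t \<open>2 * \<rho> m \<le> 1\<close> by (intro powr_mono') auto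
    also have "\<dots> \<le> (2 * \<rho> m) powr (1 / Suc m)"
      using t \<open>0 < t\<close> by (intro powr_mono2) auto
    finally show "t powr s \<le> (2 * \<rho> m) powr (1 / Suc m)" .
  qed auto
  also have "\<dots> \<le> ennreal ((1/2) ^ m)" by (intro ennreal_leI cheap)
  finally show ?thesis .
qed

text \<open>
  The costs \<open>2^-m\<close> of the stages \<open>m \<ge> M\<close> hit by \<open>D\<close> add up to at most \<open>2 * 2^-M\<close>. What remains after
  all of them is the intersection of balls with radii tending to \<open>0\<close>, at most one point.
\<close>

lemma restricted_content_K:
  assumes D: "D \<in> sorgenfrey_scales" and s: "0 < s"
  shows "restricted_content D s K = 0"
proof -
  have le: "restricted_content D s K \<le> 0 + ennreal e" if "0 < e" for e
  proof -
    obtain M1 where M1: "1 / real (Suc M1) < s"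
      using s nat_approx_posE by blast
    obtain M2 where M2: "(1/2::real) ^ M2 < e / 2"
      using real_arch_pow_inv[of "e/2" "1/2"] \<open>0 < e\<close> by auto
    define M where "M = max M1 M2"
    have Ms: "1 / Suc (m + M) \<le> s" for m
    proof -
      have "1 / real (Suc (m + M)) \<le> 1 / real (Suc M1)"
        by (intro divide_left_mono) (auto simp: M_def)
      then show ?thesis using M1 by linarith
    qed
    have Me: "2 * (1/2::real) ^ M \<le> e"
    proof -
      have "(1/2::real) ^ M \<le> (1/2) ^ M2"
        by (rule power_decreasing) (auto simp: M_def)
      then show ?thesis using M2 by linarith
    qed
    define F where
      "F m = (if hits D (m + M) then K - cball (v (m + M)) (\<rho> (m + M)) else {})" for m
    \<comment> \<open>The points that lie in the exceptional ball of every stage in use.\<close>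
    define L where "L = {x. \<forall>m\<ge>M. hits D m \<longrightarrow> x \<in> cball (v m) (\<rho> m)}"
    have "x = y" if "x \<in> L" "y \<in> L" for x y
    proof (rule ccontr)
      assume "x \<noteq> y"
      then obtain N where N: "\<forall>m\<ge>N. \<rho> m < dist x y / 2"
        using \<rho>_eventually_less[of "dist x y / 2"] by auto
      obtain m where "max N M \<le> m" "hits D m"
        using frequently_hits[OF D] by blast
      then have "x \<in> cball (v m) (\<rho> m)" "y \<in> cball (v m) (\<rho> m)" "\<rho> m < dist x y / 2"
        using that N by (auto simp: L_def simp del: mem_cball)
      then show False using dist_triangle3[of x y "v m"] by simp
    qed
    then obtain x where "L \<subseteq> {x}" by blast
    have "restricted_content D s (F m) \<le> ennreal ((1/2) ^ (m + M))" for m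
      using content_K_minus_cball_le[OF D _ Ms]
      by (simp add: F_def restricted_content_subsingleton[OF D s empty_subsetI])
    then have "(\<Sum>m. restricted_content D s (F m)) \<le> (\<Sum>m. ennreal ((1/2) ^ (m + M)))"
      by (intro suminf_le) auto
    also have "\<dots> = ennreal (2 * (1/2) ^ M)"
      using sums_mult[OF power_half_series, of "2 * (1/2) ^ M"]
      by (intro sums_unique[symmetric] sums_ennreal[THEN iffD2]) (auto simp: power_add mult_ac)
    also have "\<dots> \<le> ennreal e" using Me by (rule ennreal_leI)
    finally have F: "(\<Sum>m. restricted_content D s (F m)) \<le> ennreal e" .
    have "K \<subseteq> L \<union> (\<Union>m. F m)"
    proof
      fix x assume "x \<in> K"
      show "x \<in> L \<union> (\<Union>m. F m)"
      proof (cases "x \<in> L")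
        case False
        then obtain m where m: "M \<le> m" "hits D m" "x \<notin> cball (v m) (\<rho> m)"
          by (auto simp: L_def)
        then have "x \<in> F (m - M)" using \<open>x \<in> K\<close> by (simp add: F_def)
        then show ?thesis by blast
      qed auto
    qed
    then have "restricted_content D s K \<le> restricted_content D s (L \<union> (\<Union>m. F m))"
      by (rule restricted_content_mono)
    also have "\<dots> \<le> restricted_content D s L + restricted_content D s (\<Union>m. F m)"
      by (rule restricted_content_Un_le[OF D s])
    also have "\<dots> \<le> 0 + ennreal e"
      using restricted_content_subsingleton[OF D s \<open>L \<subseteq> {x}\<close>] F
      by (intro add_mono order.trans[OF restricted_content_UN_le]) auto
    finally show ?thesis .
  qed
  have "restricted_content D s K \<le> 0"
    by (rule ennreal_le_epsilon) (rule le)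
  then show ?thesis by simp
qed

lemma universal_dim_K: "universal_dim K = 0"
proof (rule antisym)
  show "universal_dim K \<le> 0"
    unfolding universal_dim_def
  proof (rule SUP_least)
    fix D assume D: "D \<in> sorgenfrey_scales"
    show "restricted_hausdorff_dim D K \<le> 0"
    proof (rule ereal_le_epsilon2)
      fix e :: real assume "0 < e"
      then show "restricted_hausdorff_dim D K \<le> 0 + ereal e"
        unfolding restricted_hausdorff_dim_def
        by (intro Inf_lower CollectI exI[of _ e]) (auto simp: restricted_content_K[OF D])
    qed
  qed
  obtain D where D: "D \<in> sorgenfrey_scales" using sorgenfrey_scales_nonempty by blast
  have "0 \<le> restricted_hausdorff_dim D K"
    unfolding restricted_hausdorff_dim_def by (rule Inf_greatest) auto
  also have "\<dots> \<le> universal_dim K"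
    unfolding universal_dim_def by (rule SUP_upper[OF D])
  finally show "0 \<le> universal_dim K" .
qed

section \<open>The intermediate dimension of the limit set\<close>

text \<open>
  If \<open>q m\<close> is close to a point \<open>p\<close> of \<open>P m\<close>, then the point \<open>v m\<close> nearest to \<open>q m\<close> is close to \<open>p\<close>
  as well.
\<close>

lemma frequently_cball_subset:
  assumes "open V" "V \<inter> K \<noteq> {}"
  shows "\<exists>m\<ge>M. cball (v m) (\<rho> m) \<subseteq> V"
proof -
  obtain k p where p: "p \<in> P k" "p \<in> V"
    using assms open_Int_closure_eq_empty[of V "\<Union>m. P m"] unfolding K_def by blast
  obtain r where r: "0 < r" "ball p r \<subseteq> V"
    using \<open>open V\<close> p(2) by (auto simp: open_contains_ball)
  obtain N where N: "\<forall>m\<ge>N. \<rho> m < r / 2"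
    using \<rho>_eventually_less[of "r/2"] r by auto
  have "infinite {m. q m \<in> ball p (r/4)}"
    using r by (intro q_dense) auto
  then obtain m where m: "max k (max N M) \<le> m" and "q m \<in> ball p (r/4)"
    unfolding infinite_nat_iff_unbounded_le by blast
  then have qm: "dist p (q m) < r / 4" by simp
  have "dist (v m) (q m) \<le> dist p (q m)"
    using v_nearest[of p m] P_mono[of k m] p m by auto
  then have "dist p (v m) < r / 2"
    using qm dist_triangle2[of p "v m" "q m"] by simp
  moreover have "\<rho> m < r / 2" using N m by simp
  ultimately have "cball (v m) (\<rho> m) \<subseteq> ball p r"
    by (simp add: cball_subset_ball_iff dist_commute)
  then show ?thesis using r m by (intro exI[of _ m]) auto
qed

text \<open>
  Since the net property is formulated with open balls, a dense subset inherits it with the same mesh.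
\<close>

lemma net_of_dense_subset:
  assumes "V \<inter> K \<subseteq> closure Y" "cball (v m) (\<rho> m) \<subseteq> V"
  shows "cball (v m) (\<rho> m / 2) \<subseteq> (\<Union>y\<in>Y. ball y (\<Phi> (\<delta> m)))"
proof
  fix x assume x: "x \<in> cball (v m) (\<rho> m / 2)"
  then obtain g where g: "g \<in> P (Suc m)" "dist g x < \<Phi> (\<delta> m)"
    using net[of m] by auto
  have "dist g x < \<rho> m / 2"
    using g admissible_le[OF \<Phi> \<delta>_pos[of m]] \<delta>_le[of m] by linarith
  then have "g \<in> V" using x dist_triangle2[of "v m" g x] assms(2) by auto
  then have "g \<in> closure Y" using g(1) P_subset_K[of "Suc m"] assms(1) by auto
  then obtain y where "y \<in> Y" "dist y g < \<Phi> (\<delta> m) - dist g x"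
    using closure_approachable[THEN iffD1, rule_format, of g Y "\<Phi> (\<delta> m) - dist g x"] g(2)
    by auto
  then show "x \<in> (\<Union>y\<in>Y. ball y (\<Phi> (\<delta> m)))"
    using dist_triangle[of y x g] by (auto intro!: bexI[of _ y])
qed

text \<open>
  The diameters in a permitted cover at scale \<open>\<delta> m\<close> are at least the mesh \<open>\<Phi> (\<delta> m)\<close>, so doubling
  the radii turns a cover of \<open>Y\<close> into a cover of the whole ball around \<open>v m\<close>. Volumes then bound the
  sum of the powers with exponent \<open>DIM('a)\<close> from below, and passing to an exponent \<open>s < DIM('a)\<close> gains
  the factor \<open>\<delta> m powr (s - DIM('a))\<close>, which beats the volume of the ball by the choice of \<open>\<delta> m\<close>.
\<close>

lemma DIM_le_upper_intermediate_dim: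
  assumes Y: "\<And>M. \<exists>m\<ge>M. cball (v m) (\<rho> m / 2) \<subseteq> (\<Union>y\<in>Y. ball y (\<Phi> (\<delta> m)))"
  shows "ereal (real DIM('a)) \<le> upper_intermediate_dim \<Phi> Y"
  unfolding upper_intermediate_dim_def
proof (rule Inf_greatest, clarify)
  fix s :: real
  assume s: "0 \<le> s" and covers: "\<forall>\<epsilon>>0. \<exists>\<delta>\<^sub>0>0. \<forall>\<delta>\<in>{0<..<\<delta>\<^sub>0}. \<exists>(I :: nat set) (U :: nat \<Rightarrow> 'a set).
         Y \<subseteq> (\<Union>i\<in>I. U i) \<and>
         (\<forall>i\<in>I. bounded (U i) \<and> \<Phi> \<delta> \<le> diameter (U i) \<and> diameter (U i) \<le> \<delta>) \<and>
         (\<Sum>\<^sub>\<infinity>i\<in>I. ennreal (diameter (U i) powr s)) \<le> ennreal \<epsilon>"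
  show "ereal (real DIM('a)) \<le> ereal s"
  proof (rule ccontr)
    assume "\<not> ereal (real DIM('a)) \<le> ereal s"
    then have "0 < real DIM('a) - s" by simp
    then obtain M1 where M1: "1 / real (Suc M1) < real DIM('a) - s"
      using nat_approx_posE by blast
    obtain \<delta>0 where \<delta>0: "0 < \<delta>0" and covers1: "\<forall>\<delta>\<in>{0<..<\<delta>0}. \<exists>(I :: nat set) (U :: nat \<Rightarrow> 'a set).
         Y \<subseteq> (\<Union>i\<in>I. U i) \<and>
         (\<forall>i\<in>I. bounded (U i) \<and> \<Phi> \<delta> \<le> diameter (U i) \<and> diameter (U i) \<le> \<delta>) \<and>
         (\<Sum>\<^sub>\<infinity>i\<in>I. ennreal (diameter (U i) powr s)) \<le> ennreal 1"
      using covers[rule_format, OF zero_less_one] by blast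
    obtain M2 where M2: "\<forall>m\<ge>M2. \<rho> m < \<delta>0" using \<rho>_eventually_less[OF \<delta>0] by blast
    obtain m where m: "max M1 M2 \<le> m"
      and Ym: "cball (v m) (\<rho> m / 2) \<subseteq> (\<Union>y\<in>Y. ball y (\<Phi> (\<delta> m)))"
      using Y by blast
    have "1 / real (Suc m) \<le> 1 / real (Suc M1)"
      using m by (intro divide_left_mono) auto
    then have ms: "1 / Suc m \<le> real DIM('a) - s" using M1 by linarith
    have "\<rho> m < \<delta>0" using M2 m by simp
    then have "\<delta> m \<in> {0<..<\<delta>0}" using \<delta>_pos[of m] \<delta>_le[of m] \<rho>_pos[of m] by simp
    then obtain I :: "nat set" and U :: "nat \<Rightarrow> 'a set" where
      U: "Y \<subseteq> (\<Union>i\<in>I. U i)"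
      and d: "\<And>i. i \<in> I \<Longrightarrow> bounded (U i)" "\<And>i. i \<in> I \<Longrightarrow> \<Phi> (\<delta> m) \<le> diameter (U i)"
        "\<And>i. i \<in> I \<Longrightarrow> diameter (U i) \<le> \<delta> m"
      and sum: "(\<Sum>\<^sub>\<infinity>i\<in>I. ennreal (diameter (U i) powr s)) \<le> ennreal 1"
      using covers1 by meson
    have \<Phi>_pos: "0 < \<Phi> (\<delta> m)" by (rule admissible_pos[OF \<Phi> \<delta>_pos])
    have \<delta>_le_1: "\<delta> m \<le> 1"
      using \<delta>_le[of m] \<rho>_le[of m] power_le_one[of "1/2::real" m] by simp
    \<comment> \<open>All terms are at least \<open>\<Phi> (\<delta> m) powr s\<close>, so an infinite sum would diverge.\<close>
    have "finite I"
    proof (rule ccontr)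
      assume "infinite I"
      then have "(\<Sum>\<^sub>\<infinity>i\<in>I. ennreal (diameter (U i) powr s)) = \<infinity>"
        using \<Phi>_pos d(2) s
        by (intro infsum_superconst_infinite_ennreal[where b = "ennreal (\<Phi> (\<delta> m) powr s)"])
          (auto intro!: ennreal_leI powr_mono2)
      with sum show False by (simp add: top_unique)
    qed
    have "(\<Sum>i\<in>I. ennreal (diameter (U i) powr s)) \<le> ennreal 1"
      using sum \<open>finite I\<close> by simp
    then have sum1: "(\<Sum>i\<in>I. diameter (U i) powr s) \<le> 1"
      by (simp add: sum_ennreal del: ennreal_1)
    have "\<exists>y. y \<in> U i" if "i \<in> I" for i
      using d(2)[OF that] \<Phi>_pos by (cases "U i = {}") auto
    then obtain x where x: "\<And>i. i \<in> I \<Longrightarrow> x i \<in> U i" by metis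
    have "cball (v m) (\<rho> m / 2) \<subseteq> (\<Union>i\<in>I. cball (x i) (2 * diameter (U i)))"
    proof
      fix z assume "z \<in> cball (v m) (\<rho> m / 2)"
      then obtain y where y: "y \<in> Y" "dist y z < \<Phi> (\<delta> m)" using Ym by auto
      then obtain i where i: "i \<in> I" "y \<in> U i" using U by auto
      have "dist (x i) y \<le> diameter (U i)"
        using d(1) x i by (intro diameter_bounded_bound) auto
      then have "dist (x i) z \<le> 2 * diameter (U i)"
        using y(2) d(2)[OF i(1)] dist_triangle[of "x i" z y] by linarith
      then show "z \<in> (\<Union>i\<in>I. cball (x i) (2 * diameter (U i)))" using i by auto
    qed
    then have "(\<rho> m / 2) ^ DIM('a) \<le> (\<Sum>i\<in>I. (2 * diameter (U i)) ^ DIM('a))"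
      using \<open>finite I\<close> d(1) \<rho>_pos[of m]
      by (intro power_radius_le_sum_cover[where x = x and c = "v m"]) (auto intro: diameter_ge_0)
    also have "\<dots> = 2 ^ DIM('a) * (\<Sum>i\<in>I. diameter (U i) ^ DIM('a))"
      by (simp add: power_mult_distrib sum_distrib_left)
    also have "(\<Sum>i\<in>I. diameter (U i) ^ DIM('a))
        \<le> (\<Sum>i\<in>I. \<delta> m powr (1 / Suc m) * diameter (U i) powr s)"
    proof (rule sum_mono)
      fix i assume i: "i \<in> I"
      have pos: "0 < diameter (U i)" using d(2)[OF i] \<Phi>_pos by linarith
      then have "diameter (U i) ^ DIM('a)
          = diameter (U i) powr (real DIM('a) - s) * diameter (U i) powr s"
        by (simp add: powr_add[symmetric] powr_realpow)
      also have "\<dots> \<le> \<delta> m powr (real DIM('a) - s) * diameter (U i) powr s"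
        using pos d(3)[OF i] \<open>0 < real DIM('a) - s\<close> by (intro mult_right_mono powr_mono2) auto
      also have "\<dots> \<le> \<delta> m powr (1 / Suc m) * diameter (U i) powr s"
        using ms \<delta>_pos[of m] \<delta>_le_1 by (intro mult_right_mono powr_mono') auto
      finally show "diameter (U i) ^ DIM('a) \<le> \<delta> m powr (1 / Suc m) * diameter (U i) powr s" .
    qed
    also have "\<dots> \<le> \<delta> m powr (1 / Suc m)"
      using sum1 by (simp add: sum_distrib_left[symmetric] mult_left_le)
    finally have "(\<rho> m / 2) ^ DIM('a) \<le> 2 ^ DIM('a) * \<delta> m powr (1 / Suc m)" by simp
    moreover have "(\<rho> m / 2) ^ DIM('a) = 2 ^ DIM('a) * (\<rho> m / 4) ^ DIM('a)"
      by (simp add: power_mult_distrib[symmetric])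
    ultimately have "(\<rho> m / 4) ^ DIM('a) \<le> \<delta> m powr (1 / Suc m)" by simp
    with \<delta>_small[of m] show False by linarith
  qed
qed

lemma DIM_le_modified_upper_intermediate_dim:
  "ereal (real DIM('a)) \<le> modified_upper_intermediate_dim \<Phi> K"
  unfolding modified_upper_intermediate_dim_def
proof (rule Inf_greatest, clarify)
  fix Y :: "nat \<Rightarrow> 'a set" assume Y: "K = (\<Union>i. Y i)"
  have "K \<noteq> {}" using v_in[of 0] P_subset_K[of 0] by auto
  moreover have "closed K" by (simp add: K_def)
  ultimately obtain i V where V: "open V" "V \<inter> K \<noteq> {}" "V \<inter> K \<subseteq> closure (Y i)"
    using Y by (elim closed_UN_somewhere_dense[of K Y]) auto
  have "ereal (real DIM('a)) \<le> upper_intermediate_dim \<Phi> (Y i)"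
    using frequently_cball_subset[OF V(1,2)] net_of_dense_subset[OF V(3)]
    by (intro DIM_le_upper_intermediate_dim) meson
  also have "\<dots> \<le> (SUP i. upper_intermediate_dim \<Phi> (Y i))"
    by (rule SUP_upper) simp
  finally show "ereal (real DIM('a)) \<le> (SUP i. upper_intermediate_dim \<Phi> (Y i))" .
qed

end

section \<open>Existence of the construction\<close>

lemma ex_small_powr:
  fixes a b e :: real
  assumes "0 < a" "0 < b" "0 < e"
  shows "\<exists>r>0. r \<le> a \<and> r powr b < e"
proof (intro exI conjI)
  let ?r = "min a ((e / 2) powr (1 / b))"
  show "0 < ?r" "?r \<le> a" using assms by auto
  have "?r powr b \<le> ((e / 2) powr (1 / b)) powr b"
    using assms by (intro powr_mono2) auto
  also have "\<dots> < e" using assms by (simp add: powr_powr)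
  finally show "?r powr b < e" .
qed

lemma ex_recurrent_dense_sequence:
  obtains q :: "nat \<Rightarrow> 'a::euclidean_space"
  where "\<And>V. open V \<Longrightarrow> V \<noteq> {} \<Longrightarrow> infinite {m. q m \<in> V}"
proof -
  obtain D :: "'a set" where D: "countable D" "\<And>V. open V \<Longrightarrow> V \<noteq> {} \<Longrightarrow> \<exists>d\<in>D. d \<in> V"
    using countable_dense_setE by blast
  define q where "q m = from_nat_into D (fst (prod_decode m))" for m
  have "infinite {m. q m \<in> V}" if V: "open V" "V \<noteq> {}" for V
  proof -
    obtain d where "d \<in> D" "d \<in> V" using D(2)[OF V] by blast
    then obtain i where i: "from_nat_into D i = d"
      using from_nat_into_surj[OF D(1)] by blast
    have "range (\<lambda>j. prod_encode (i, j)) \<subseteq> {m. q m \<in> V}"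
      using i \<open>d \<in> V\<close> by (auto simp: q_def)
    moreover have "infinite (range (\<lambda>j. prod_encode (i, j)))"
      by (intro range_inj_infinite injI) simp
    ultimately show ?thesis by (rule infinite_super)
  qed
  then show thesis by (rule that)
qed

text \<open>
  The order of choices: the mesh scale \<open>\<delta>\<close> depends on the current radius, the net on \<open>\<delta>\<close>, and the
  next radius on the cardinality of the enlarged set.
\<close>

lemma ex_cluster_step:
  fixes \<Phi> :: "real \<Rightarrow> real" and c :: "'a::euclidean_space"
  assumes \<Phi>: "admissible \<Phi>" and P: "finite P" and \<rho>: "0 < \<rho>"
  obtains P' \<rho>' \<delta> where "finite P'" "P \<subseteq> P'" "P' \<subseteq> P \<union> cball c (\<rho> / 2)"
    "0 < \<rho>'" "\<rho>' \<le> \<rho> / 2" "card P' * (2 * \<rho>') powr (1 / Suc m) \<le> (1/2) ^ m"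
    "0 < \<delta>" "\<delta> \<le> \<rho> / 2" "\<delta> powr (1 / Suc k) < (\<rho> / 4) ^ DIM('a)"
    "cball c (\<rho> / 2) \<subseteq> (\<Union>g\<in>P'. ball g (\<Phi> \<delta>))"
proof -
  obtain \<delta> where \<delta>: "0 < \<delta>" "\<delta> \<le> \<rho> / 2" "\<delta> powr (1 / Suc k) < (\<rho> / 4) ^ DIM('a)"
    using ex_small_powr[of "\<rho> / 2" "1 / Suc k" "(\<rho> / 4) ^ DIM('a)"] \<rho> by auto
  have "\<exists>G. finite G \<and> G \<subseteq> cball c (\<rho> / 2) \<and> cball c (\<rho> / 2) \<subseteq> (\<Union>g\<in>G. ball g (\<Phi> \<delta>))"
    using seq_compact_imp_totally_bounded[OF compact_imp_seq_compact[OF compact_cball]]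
      admissible_pos[OF \<Phi> \<delta>(1)] by blast
  then obtain G where G: "finite G" "G \<subseteq> cball c (\<rho> / 2)"
    "cball c (\<rho> / 2) \<subseteq> (\<Union>g\<in>G. ball g (\<Phi> \<delta>))" by blast
  let ?N = "real (card (P \<union> G)) + 1"
  obtain r where r: "0 < r" "r \<le> \<rho>" "r powr (1 / Suc m) < (1/2) ^ m / ?N"
    using ex_small_powr[of \<rho> "1 / Suc m" "(1/2) ^ m / ?N"] \<rho> by auto
  have "card (P \<union> G) * r powr (1 / Suc m) \<le> ?N * r powr (1 / Suc m)"
    by (intro mult_right_mono) auto
  also have "\<dots> \<le> (1/2) ^ m"
    using r(3) by (simp add: pos_less_divide_eq mult.commute)
  finally have "card (P \<union> G) * (2 * (r / 2)) powr (1 / Suc m) \<le> (1/2) ^ m" by simp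
  then show thesis
    using P G r \<delta> by (intro that[of "P \<union> G" "r / 2" \<delta>]) auto
qed

lemma ex_cluster_scheme:
  assumes \<Phi>: "admissible \<Phi>"
  shows "\<exists>(q :: nat \<Rightarrow> 'a::euclidean_space) P v \<rho> \<delta>. cluster_scheme \<Phi> q P v \<rho> \<delta>"
proof -
  obtain q :: "nat \<Rightarrow> 'a" where q: "\<And>V. open V \<Longrightarrow> V \<noteq> {} \<Longrightarrow> infinite {m. q m \<in> V}"
    using ex_recurrent_dense_sequence by blast
  \<comment> \<open>A state is the pair of the finite set and the radius of a stage; the auxiliary scale \<open>\<delta>\<close> is
    determined only in the transition, after the radius is known.\<close>
  define near where "near m P = arg_min_on (\<lambda>p. dist p (q m)) P" for m P
  define inv where "inv m = (\<lambda>(P :: 'a set, \<rho>). finite P \<and> P \<noteq> {} \<and> 0 < \<rho> \<and> \<rho> \<le> (1/2) ^ Suc m \<and>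
      card P * (2 * \<rho>) powr (1 / Suc m) \<le> (1/2) ^ m)" for m
  define good where "good m P \<rho> P' \<delta> \<longleftrightarrow> 0 < \<delta> \<and> \<delta> \<le> \<rho> / 2 \<and>
      \<delta> powr (1 / Suc m) < (\<rho> / 4) ^ DIM('a) \<and>
      cball (near m P) (\<rho> / 2) \<subseteq> (\<Union>g\<in>P'. ball g (\<Phi> \<delta>))" for m P \<rho> P' \<delta>
  define step where "step m = (\<lambda>(P, \<rho>) (P', \<rho>'). P \<subseteq> P' \<and>
      P' \<subseteq> P \<union> cball (near m P) (\<rho> / 2) \<and> \<rho>' \<le> \<rho> / 2 \<and> (\<exists>\<delta>. good m P \<rho> P' \<delta>))" for m
  have "\<exists>f. \<forall>m. inv m (f m) \<and> step m (f m) (f (Suc m))"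
  proof (rule dependent_nat_choice)
    have "inv 0 ({0}, 1/2)" by (simp add: inv_def)
    then show "\<exists>x. inv 0 x" ..
  next
    fix x m assume "inv m x"
    then obtain P \<rho> where x: "x = (P, \<rho>)" and P: "finite P" "P \<noteq> {}" "0 < \<rho>" "\<rho> \<le> (1/2) ^ Suc m"
      by (cases x) (simp add: inv_def)
    obtain P' \<rho>' \<delta> where *: "finite P'" "P \<subseteq> P'" "P' \<subseteq> P \<union> cball (near m P) (\<rho> / 2)"
      "0 < \<rho>'" "\<rho>' \<le> \<rho> / 2" "card P' * (2 * \<rho>') powr (1 / Suc (Suc m)) \<le> (1/2) ^ Suc m"
      "0 < \<delta>" "\<delta> \<le> \<rho> / 2" "\<delta> powr (1 / Suc m) < (\<rho> / 4) ^ DIM('a)"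
      "cball (near m P) (\<rho> / 2) \<subseteq> (\<Union>g\<in>P'. ball g (\<Phi> \<delta>))"
      by (rule ex_cluster_step[OF \<Phi> P(1,3)])
    have "\<rho>' \<le> (1/2) ^ Suc (Suc m)" using *(5) P(4) by simp
    then have "inv (Suc m) (P', \<rho>')" using * P(2) unfolding inv_def by blast
    moreover have "step m x (P', \<rho>')" using * unfolding x step_def good_def by blast
    ultimately show "\<exists>y. inv (Suc m) y \<and> step m x y" by blast
  qed
  then obtain f where f: "\<And>m. inv m (f m)" "\<And>m. step m (f m) (f (Suc m))" by blast
  define P where "P m = fst (f m)" for m
  define \<rho> where "\<rho> m = snd (f m)" for m
  define v where "v m = near m (P m)" for m
  have "\<exists>\<delta>. good m (P m) (\<rho> m) (P (Suc m)) \<delta>" for m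
    using f(2)[of m] by (auto simp: step_def P_def \<rho>_def split: prod.splits)
  then obtain \<delta> where \<delta>: "\<And>m. good m (P m) (\<rho> m) (P (Suc m)) (\<delta> m)" by metis
  have inv: "finite (P m)" "P m \<noteq> {}" "0 < \<rho> m" "\<rho> m \<le> (1/2) ^ Suc m"
    "card (P m) * (2 * \<rho> m) powr (1 / Suc m) \<le> (1/2) ^ m" for m
    using f(1)[of m] by (auto simp: inv_def P_def \<rho>_def split: prod.splits)
  have step: "P m \<subseteq> P (Suc m)" "P (Suc m) \<subseteq> P m \<union> cball (v m) (\<rho> m / 2)"
    "\<rho> (Suc m) \<le> \<rho> m / 2" for m
    using f(2)[of m] unfolding step_def v_def P_def \<rho>_def by (simp_all add: case_prod_unfold)
  have "cluster_scheme \<Phi> q P v \<rho> \<delta>"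
  proof (rule cluster_scheme.intro)
    fix m
    show "v m \<in> P m"
      unfolding v_def near_def by (rule arg_min_if_finite(1)[OF inv(1,2)])
    show "dist (v m) (q m) \<le> dist p (q m)" if "p \<in> P m" for p
      unfolding v_def near_def by (rule arg_min_least[OF inv(1,2) that])
    show "0 < \<delta> m" "\<delta> m \<le> \<rho> m / 2" "\<delta> m powr (1 / Suc m) < (\<rho> m / 4) ^ DIM('a)"
      "cball (v m) (\<rho> m / 2) \<subseteq> (\<Union>g\<in>P (Suc m). ball g (\<Phi> (\<delta> m)))"
      using \<delta>[of m] by (simp_all add: good_def v_def)
  qed (rule \<Phi> q inv step; assumption)+
  then show ?thesis by blast
qed

theorem theorem4p6:
  fixes \<Phi> :: "real \<Rightarrow> real"
  assumes "admissible \<Phi>"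
  shows "\<exists>K :: (real ^ 'n) set. compact K \<and>
           universal_dim K = 0 \<and>
           modified_upper_intermediate_dim \<Phi> K = ereal (real CARD('n)) \<and>
           packing_dim K = ereal (real CARD('n))"
proof -
  obtain q :: "nat \<Rightarrow> real ^ 'n" and P v \<rho> \<delta> where "cluster_scheme \<Phi> q P v \<rho> \<delta>"
    using ex_cluster_scheme[OF assms] by blast
  then interpret cluster_scheme \<Phi> q P v \<rho> \<delta> .
  have "bounded K" using compact_K by (rule compact_imp_bounded)
  have lower: "ereal (real CARD('n)) \<le> modified_upper_intermediate_dim \<Phi> K"
    using DIM_le_modified_upper_intermediate_dim by simp
  have middle: "modified_upper_intermediate_dim \<Phi> K \<le> packing_dim K"
    by (rule modified_upper_intermediate_dim_le_packing_dim[OF assms \<open>bounded K\<close>])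
  have upper: "packing_dim K \<le> ereal (real CARD('n))"
    using packing_dim_le_DIM[OF \<open>bounded K\<close>] by simp
  show ?thesis
  proof (intro exI conjI)
    show "modified_upper_intermediate_dim \<Phi> K = ereal (real CARD('n))"
      by (rule antisym[OF order.trans[OF middle upper] lower])
    show "packing_dim K = ereal (real CARD('n))"
      by (rule antisym[OF upper order.trans[OF lower middle]])
  qed (rule compact_K universal_dim_K)+
qed

end
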